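(* Let $p,q\ge 1$ and let $C=(C^1,\dots,C^p)\in\mathfrak{so}(q)^p$ be a tuple of linearly independent skew-symmetric matrices. If the orbit $SL_q\mathbb R\cdot C$ is closed in $\mathfrak{so}(q)^p$, then the Lie group $N_C$ corresponding to $C$ admits a left-invariant metric that is a trivial Ricci Yang-Mills soliton. Moreover, the trivial Ricci Yang-Mills soliton metrics are precisely the geodesically flow-invariant metrics: for every tuple $C'\in\mathfrak{so}(q)^p$ of linearly independent matrices, the left-invariant metric of $N_{C'}$ is a trivial Ricci Yang-Mills soliton if and only if it is geodesically flow invariant.
   Context: **The group $N_C$.** Given a tuple $C=(C^1,\dots,C^p)$ of linearly independent elements of $\mathfrak{so}(q)$ (real skew-symmetric $q\times q$ matrices), $\mathfrak N_C$ is the Lie algebra $\mathbb R^q\oplus\mathbb R^p$ with standard basis $e_1,\dots,e_{q+p}$ (declared orthonormal) and bracket $[e_i,e_j]=\sum_k C^k_{ij}e_{q+k}$ for $1\le i,j\le q$, all other brackets of basis vectors being zero. $N_C$ is the simply connected Lie group with Lie algebra $\mathfrak N_C$ and the corresponding left-invariant metric. **Bundle data.** For a simply connected 2-step nilpotent Lie group $N$ with a left-invariant metric and Lie algebra $\mathfrak N$, let $Z=[N,N]$ (a central subgroup), $\mathfrak Z=\mathrm{Lie}(Z)$, $\mathcal H=\mathfrak Z^\perp$. Then $\pi:N\to M=N/Z$ is a principal bundle with abelian structure group $G\simeq Z$ acting by right multiplication, with Lie algebra $\mathfrak g\simeq\mathfrak Z$ carrying the restricted inner product $k$. The connection $\omega$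 is the left-invariant $\mathfrak g$-valued 1-form which vanishes on $\mathcal H$ and is the identification $\mathfrak Z\simeq\mathfrak g$ on $\mathfrak Z$. The curvature $\Omega=d\omega$ descends to a $\mathfrak g$-valued 2-form $\tilde\Omega$ on $M$. Let $g$ be the induced metric on $M$, and set $\tilde\Omega^2_{ij}=\sum g^{kl}k^{\alpha\beta}\tilde\Omega_{\alpha ki}\tilde\Omega_{\beta lj}$ (Greek indices: indices in $\mathfrak g$; Roman indices: indices on $M$). **Ricci Yang-Mills soliton.** The metric on $N$ is a Ricci Yang-Mills soliton if there are $\lambda\in\mathbb R$ and a vector field $X$ on $M$ with $$\tilde\Omega^2-2Rc(g)=\lambda g+\mathcal L_Xg,\qquad \Delta_d\tilde\Omega=\mathcal L_X\tilde\Omega,$$ where $\Delta_d$ is the Hodge Laplacian. It is trivial if these equations hold with $X=0$. **Action and minimal points.** $SL_q\mathbb R\subset GL_q\mathbb R$ acts on $\mathfrak{so}(q)^p$ by $a\cdot C=(aC^1a^t,\dots,aC^pa^t)$, and $X\in\mathfrak{gl}_q\mathbb R$ acts by $X\cdot C=(XC^1+C^1X^t,\dots,XC^p+C^pX^t)$. The moment map of the $GL_q\mathbb R$-action is $m_1(C)=-2\sum_\alpha(C^\alpha)^2$; that of the $SL_q\mathbb R$-action is its trace-free part $m_{SL_q}(C)=m_1(C)-\frac1q\mathrm{tr}(m_1(C))\,Id$. A point $C$ is $SL_q\mathbb R$-minimal if $m_{SL_q}(C)\cdot C=0$. **Geodesically flow invariant.** The left-invariant metric of $N_C$ is called geodesically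 flow invariant if $C$ is an $SL_q\mathbb R$-minimal point. *)

theory Defs
  imports "HOL-Analysis.Analysis"
begin

section \<open>The nilpotent Lie algebra and its group\<close>

definition so_tuples :: "(real^'q^'q^'p) set" where
  "so_tuples = {C. \<forall>k. transpose (C $ k) = - (C $ k)}"

definition lin_indep_tuple :: "real^'q^'q^'p \<Rightarrow> bool" where
  "lin_indep_tuple C \<longleftrightarrow> (\<forall>c :: 'p \<Rightarrow> real. (\<Sum>k\<in>UNIV. c k *\<^sub>R (C $ k)) = 0 \<longrightarrow> (\<forall>k. c k = 0))"

text \<open>The underlying space of the Lie algebra is the product type; its library inner product is
  the one for which the standard basis is orthonormal.\<close>

type_synonym ('q, 'p) nil = "(real^'q) \<times> (real^'p)"

definition lie_bracket :: "real^'q^'q^'p \<Rightarrow> ('q::finite, 'p::finite) nil \<Rightarrow> ('q, 'p) nil \<Rightarrow> ('q, 'p) nil" where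
  "lie_bracket C u v = (0, \<chi> k. \<Sum>i\<in>UNIV. \<Sum>j\<in>UNIV. C $ k $ i $ j * fst u $ i * fst v $ j)"

definition derived_algebra :: "real^'q^'q^'p \<Rightarrow> ('q::finite, 'p::finite) nil set" where
  "derived_algebra C = span {lie_bracket C u v | u v. True}"

text \<open>The simply connected group in exponential coordinates: the exponential map is the identity
  of the Lie algebra and the product is the Baker-Campbell-Hausdorff series, which stops after the
  first bracket. For skew-symmetric matrices the inverse of an element is its negative.\<close>

definition lie_mult :: "real^'q^'q^'p \<Rightarrow> ('q::finite, 'p::finite) nil \<Rightarrow> ('q, 'p) nil \<Rightarrow> ('q, 'p) nil" where
  "lie_mult C x y = x + y + (1/2) *\<^sub>R lie_bracket C x y"

definition transl_diff :: "real^'q^'q^'p \<Rightarrow> ('q::finite, 'p::finite) nil \<Rightarrow> ('q, 'p) nil \<Rightarrow> ('q, 'p) nil \<Rightarrow> ('q, 'p) nil" where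
  "transl_diff C a x = frechet_derivative (lie_mult C a) (at x)"

section \<open>Left-invariant metrics\<close>

definition inner_product :: "('a::real_vector \<Rightarrow> 'a \<Rightarrow> real) \<Rightarrow> bool" where
  "inner_product b \<longleftrightarrow> bilinear b \<and> (\<forall>u v. b u v = b v u) \<and> (\<forall>u. u \<noteq> 0 \<longrightarrow> b u u > 0)"

text \<open>A metric is a family of inner products \<open>h n\<close> on the tangent spaces at \<open>n\<close>; for
  left-invariant families smoothness in \<open>n\<close> is automatic.\<close>

definition left_invariant_metric ::
  "real^'q^'q^'p \<Rightarrow> (('q::finite, 'p::finite) nil \<Rightarrow> ('q, 'p) nil \<Rightarrow> ('q, 'p) nil \<Rightarrow> real) \<Rightarrow> bool" where
  "left_invariant_metric C h \<longleftrightarrow> (\<forall>n. inner_product (h n)) \<and>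
     (\<forall>a n u v. h (lie_mult C a n) (transl_diff C a n u) (transl_diff C a n v) = h n u v)"

definition std_metric ::
  "real^'q^'q^'p \<Rightarrow> ('q::finite, 'p::finite) nil \<Rightarrow> ('q, 'p) nil \<Rightarrow> ('q, 'p) nil \<Rightarrow> real" where
  "std_metric C n u v = transl_diff C (- n) n u \<bullet> transl_diff C (- n) n v"

section \<open>Bundle data\<close>

text \<open>For linearly independent tuples the derived algebra is \<open>{0} \<times> UNIV\<close>, and the fibres of
  \<^term>\<open>fst\<close> are the cosets of the subgroup \<open>Z\<close> (lemmas \<open>derived_algebra_eq\<close> and
  \<open>fst_eq_iff_coset\<close> below). So \<open>M = N/Z\<close> is \<^typ>\<open>real^'q\<close> with projection \<^term>\<open>fst\<close>, and
  \<open>\<gg>\<close> is \<^typ>\<open>real^'p\<close>, where \<open>z\<close> corresponds to \<open>(0, z)\<close>.\<close>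

definition horizontal ::
  "real^'q^'q^'p \<Rightarrow> (('q::finite, 'p::finite) nil \<Rightarrow> ('q, 'p) nil \<Rightarrow> ('q, 'p) nil \<Rightarrow> real) \<Rightarrow>
   ('q, 'p) nil \<Rightarrow> ('q, 'p) nil set" where
  "horizontal C h n = {u. \<forall>z\<in>derived_algebra C. h n u (transl_diff C n 0 z) = 0}"

definition is_connection ::
  "real^'q^'q^'p \<Rightarrow> (('q::finite, 'p::finite) nil \<Rightarrow> ('q, 'p) nil \<Rightarrow> ('q, 'p) nil \<Rightarrow> real) \<Rightarrow>
   (('q, 'p) nil \<Rightarrow> ('q, 'p) nil \<Rightarrow> real^'p) \<Rightarrow> bool" where
  "is_connection C h \<omega> \<longleftrightarrow> (\<forall>n. linear (\<omega> n)) \<and>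
     (\<forall>a n u. \<omega> (lie_mult C a n) (transl_diff C a n u) = \<omega> n u) \<and>
     (\<forall>n. \<forall>u\<in>horizontal C h n. \<omega> n u = 0) \<and>
     (\<forall>n z. \<omega> n (transl_diff C n 0 (0, z)) = z)"

definition connection ::
  "real^'q^'q^'p \<Rightarrow> (('q::finite, 'p::finite) nil \<Rightarrow> ('q, 'p) nil \<Rightarrow> ('q, 'p) nil \<Rightarrow> real) \<Rightarrow>
   ('q, 'p) nil \<Rightarrow> ('q, 'p) nil \<Rightarrow> real^'p" where
  "connection C h = (THE \<omega>. is_connection C h \<omega>)"

text \<open>The exterior derivative, with the convention
  \<open>d\<omega>(U, V) = U(\<omega> V) - V(\<omega> U) - \<omega>[U, V]\<close>, evaluated on constant vector fields.\<close>

definition curvature ::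
  "real^'q^'q^'p \<Rightarrow> (('q::finite, 'p::finite) nil \<Rightarrow> ('q, 'p) nil \<Rightarrow> ('q, 'p) nil \<Rightarrow> real) \<Rightarrow>
   ('q, 'p) nil \<Rightarrow> ('q, 'p) nil \<Rightarrow> ('q, 'p) nil \<Rightarrow> real^'p" where
  "curvature C h n u v =
     frechet_derivative (\<lambda>m. connection C h m v) (at n) u -
     frechet_derivative (\<lambda>m. connection C h m u) (at n) v"

text \<open>The form on \<open>M\<close> whose pullback under the projection is the curvature.\<close>

definition base_curvature ::
  "real^'q^'q^'p \<Rightarrow> (('q::finite, 'p::finite) nil \<Rightarrow> ('q, 'p) nil \<Rightarrow> ('q, 'p) nil \<Rightarrow> real) \<Rightarrow>
   real^'q \<Rightarrow> real^'q \<Rightarrow> real^'q \<Rightarrow> real^'p" where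
  "base_curvature C h =
     (THE W. \<forall>n u v. W (fst n) (fst u) (fst v) = curvature C h n u v)"

text \<open>The metric on \<open>M\<close> for which the projection is a Riemannian submersion.\<close>

definition base_metric ::
  "real^'q^'q^'p \<Rightarrow> (('q::finite, 'p::finite) nil \<Rightarrow> ('q, 'p) nil \<Rightarrow> ('q, 'p) nil \<Rightarrow> real) \<Rightarrow>
   real^'q \<Rightarrow> real^'q \<Rightarrow> real^'q \<Rightarrow> real" where
  "base_metric C h =
     (THE g. \<forall>n. \<forall>u\<in>horizontal C h n. \<forall>v\<in>horizontal C h n. g (fst n) (fst u) (fst v) = h n u v)"

definition fibre_metric ::
  "(('q::finite, 'p::finite) nil \<Rightarrow> ('q, 'p) nil \<Rightarrow> ('q, 'p) nil \<Rightarrow> real) \<Rightarrow> real^'p \<Rightarrow> real^'p \<Rightarrow> real" where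
  "fibre_metric h a b = h 0 (0, a) (0, b)"

section \<open>Tensor calculus in the global coordinates of the base\<close>

text \<open>A covariant tensor field is given by its components: \<open>T x i j\<close> is the value at \<open>x\<close> on the
  \<open>i\<close>-th and \<open>j\<close>-th coordinate fields, in \<open>\<real>\<close> or, for \<open>\<gg>\<close>-valued forms, in a normed
  space. The structure group is abelian, so \<open>\<gg>\<close>-valued forms need no twisting.\<close>

definition components :: "(real^'n \<Rightarrow> real^'n \<Rightarrow> real^'n \<Rightarrow> 'a) \<Rightarrow> real^'n \<Rightarrow> 'n::finite \<Rightarrow> 'n \<Rightarrow> 'a" where
  "components T x i j = T x (axis i 1) (axis j 1)"

definition pd :: "'n::finite \<Rightarrow> (real^'n \<Rightarrow> 'a::real_normed_vector) \<Rightarrow> real^'n \<Rightarrow> 'a" where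
  "pd i f x = frechet_derivative f (at x) (axis i 1)"

definition inv_metric :: "(real^'n \<Rightarrow> 'n \<Rightarrow> 'n \<Rightarrow> real) \<Rightarrow> real^'n \<Rightarrow> 'n::finite \<Rightarrow> 'n \<Rightarrow> real" where
  "inv_metric g x i j = matrix_inv (\<chi> a b. g x a b) $ i $ j"

text \<open>\<open>christoffel g x k i j\<close> has upper index \<open>k\<close>.\<close>

definition christoffel :: "(real^'n \<Rightarrow> 'n \<Rightarrow> 'n \<Rightarrow> real) \<Rightarrow> real^'n \<Rightarrow> 'n::finite \<Rightarrow> 'n \<Rightarrow> 'n \<Rightarrow> real" where
  "christoffel g x k i j = (1/2) * (\<Sum>l\<in>UNIV. inv_metric g x k l *
     (pd i (\<lambda>y. g y j l) x + pd j (\<lambda>y. g y i l) x - pd l (\<lambda>y. g y i j) x))"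

definition ricci :: "(real^'n \<Rightarrow> 'n \<Rightarrow> 'n \<Rightarrow> real) \<Rightarrow> real^'n \<Rightarrow> 'n::finite \<Rightarrow> 'n \<Rightarrow> real" where
  "ricci g x i j =
     (\<Sum>k\<in>UNIV. pd k (\<lambda>y. christoffel g y k i j) x - pd j (\<lambda>y. christoffel g y k i k) x) +
     (\<Sum>k\<in>UNIV. \<Sum>l\<in>UNIV. christoffel g x k k l * christoffel g x l i j -
                          christoffel g x k j l * christoffel g x l i k)"

definition lie_derivative ::
  "(real^'n \<Rightarrow> real^'n) \<Rightarrow> (real^'n \<Rightarrow> 'n \<Rightarrow> 'n \<Rightarrow> 'a::real_normed_vector) \<Rightarrow>
   real^'n \<Rightarrow> 'n::finite \<Rightarrow> 'n \<Rightarrow> 'a" where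
  "lie_derivative X T x i j = (\<Sum>k\<in>UNIV. X x $ k *\<^sub>R pd k (\<lambda>y. T y i j) x +
     pd i (\<lambda>y. X y $ k) x *\<^sub>R T x k j + pd j (\<lambda>y. X y $ k) x *\<^sub>R T x i k)"

definition ext_deriv1 ::
  "(real^'n \<Rightarrow> 'n \<Rightarrow> 'a::real_normed_vector) \<Rightarrow> real^'n \<Rightarrow> 'n::finite \<Rightarrow> 'n \<Rightarrow> 'a" where
  "ext_deriv1 A x i j = pd i (\<lambda>y. A y j) x - pd j (\<lambda>y. A y i) x"

definition ext_deriv2 ::
  "(real^'n \<Rightarrow> 'n \<Rightarrow> 'n \<Rightarrow> 'a::real_normed_vector) \<Rightarrow> real^'n \<Rightarrow> 'n::finite \<Rightarrow> 'n \<Rightarrow> 'n \<Rightarrow> 'a" where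
  "ext_deriv2 W x i j k =
     pd i (\<lambda>y. W y j k) x + pd j (\<lambda>y. W y k i) x + pd k (\<lambda>y. W y i j) x"

text \<open>Covariant derivatives; the first index after the point is the differentiation index.\<close>

definition cov_deriv2 ::
  "(real^'n \<Rightarrow> 'n \<Rightarrow> 'n \<Rightarrow> real) \<Rightarrow> (real^'n \<Rightarrow> 'n \<Rightarrow> 'n \<Rightarrow> 'a::real_normed_vector) \<Rightarrow>
   real^'n \<Rightarrow> 'n::finite \<Rightarrow> 'n \<Rightarrow> 'n \<Rightarrow> 'a" where
  "cov_deriv2 g W x l i j = pd l (\<lambda>y. W y i j) x -
     (\<Sum>m\<in>UNIV. christoffel g x m l i *\<^sub>R W x m j + christoffel g x m l j *\<^sub>R W x i m)"

definition cov_deriv3 ::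
  "(real^'n \<Rightarrow> 'n \<Rightarrow> 'n \<Rightarrow> real) \<Rightarrow> (real^'n \<Rightarrow> 'n \<Rightarrow> 'n \<Rightarrow> 'n \<Rightarrow> 'a::real_normed_vector) \<Rightarrow>
   real^'n \<Rightarrow> 'n::finite \<Rightarrow> 'n \<Rightarrow> 'n \<Rightarrow> 'n \<Rightarrow> 'a" where
  "cov_deriv3 g P x l i j k = pd l (\<lambda>y. P y i j k) x -
     (\<Sum>m\<in>UNIV. christoffel g x m l i *\<^sub>R P x m j k + christoffel g x m l j *\<^sub>R P x i m k +
                christoffel g x m l k *\<^sub>R P x i j m)"

text \<open>The formal adjoint \<open>d\<^sup>*\<close> of the exterior derivative is minus the metric divergence.\<close>

definition codiff2 ::
  "(real^'n \<Rightarrow> 'n \<Rightarrow> 'n \<Rightarrow> real) \<Rightarrow> (real^'n \<Rightarrow> 'n \<Rightarrow> 'n \<Rightarrow> 'a::real_normed_vector) \<Rightarrow>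
   real^'n \<Rightarrow> 'n::finite \<Rightarrow> 'a" where
  "codiff2 g W x i = - (\<Sum>k\<in>UNIV. \<Sum>l\<in>UNIV. inv_metric g x k l *\<^sub>R cov_deriv2 g W x k l i)"

definition codiff3 ::
  "(real^'n \<Rightarrow> 'n \<Rightarrow> 'n \<Rightarrow> real) \<Rightarrow> (real^'n \<Rightarrow> 'n \<Rightarrow> 'n \<Rightarrow> 'n \<Rightarrow> 'a::real_normed_vector) \<Rightarrow>
   real^'n \<Rightarrow> 'n::finite \<Rightarrow> 'n \<Rightarrow> 'a" where
  "codiff3 g P x i j = - (\<Sum>k\<in>UNIV. \<Sum>l\<in>UNIV. inv_metric g x k l *\<^sub>R cov_deriv3 g P x k l i j)"

text \<open>\<open>d d\<^sup>* + d\<^sup>* d\<close> on 2-forms. The opposite sign convention gives the same trivial solitons.\<close>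

definition hodge_laplacian2 ::
  "(real^'n \<Rightarrow> 'n \<Rightarrow> 'n \<Rightarrow> real) \<Rightarrow> (real^'n \<Rightarrow> 'n \<Rightarrow> 'n \<Rightarrow> 'a::real_normed_vector) \<Rightarrow>
   real^'n \<Rightarrow> 'n::finite \<Rightarrow> 'n \<Rightarrow> 'a" where
  "hodge_laplacian2 g W x i j =
     ext_deriv1 (codiff2 g W) x i j + codiff3 g (ext_deriv2 W) x i j"

section \<open>Ricci Yang-Mills solitons\<close>

text \<open>\<open>\<Omega>\<^sup>2\<^sub>i\<^sub>j = g\<^sup>k\<^sup>l k\<^sup>\<alpha>\<^sup>\<beta> \<Omega>\<^sub>\<alpha>\<^sub>k\<^sub>i \<Omega>\<^sub>\<beta>\<^sub>l\<^sub>j\<close>, where the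
  index in \<open>\<gg>\<close> is lowered with the inner product \<open>\<kappa>\<close>.\<close>

definition curvature_sq ::
  "(real^'n \<Rightarrow> 'n \<Rightarrow> 'n \<Rightarrow> real) \<Rightarrow> (real^'p \<Rightarrow> real^'p \<Rightarrow> real) \<Rightarrow>
   (real^'n \<Rightarrow> 'n \<Rightarrow> 'n \<Rightarrow> real^'p::finite) \<Rightarrow> real^'n \<Rightarrow> 'n::finite \<Rightarrow> 'n \<Rightarrow> real" where
  "curvature_sq g \<kappa> W x i j =
     (\<Sum>k\<in>UNIV. \<Sum>l\<in>UNIV. \<Sum>\<alpha>\<in>UNIV. \<Sum>\<beta>\<in>UNIV. inv_metric g x k l *
        matrix_inv (\<chi> a b. \<kappa> (axis a 1) (axis b 1)) $ \<alpha> $ \<beta> *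
        \<kappa> (axis \<alpha> 1) (W x k i) * \<kappa> (axis \<beta> 1) (W x l j))"

definition rym_soliton_eqs ::
  "real^'q^'q^'p \<Rightarrow> (('q::finite, 'p::finite) nil \<Rightarrow> ('q, 'p) nil \<Rightarrow> ('q, 'p) nil \<Rightarrow> real) \<Rightarrow>
   real \<Rightarrow> (real^'q \<Rightarrow> real^'q) \<Rightarrow> bool" where
  "rym_soliton_eqs C h c X \<longleftrightarrow>
     (let g = components (base_metric C h); W = components (base_curvature C h) in
       (\<forall>x i j. curvature_sq g (fibre_metric h) W x i j - 2 * ricci g x i j =
                c * g x i j + lie_derivative X g x i j) \<and>
       (\<forall>x i j. hodge_laplacian2 g W x i j = lie_derivative X W x i j))"

definition trivial_rym_soliton ::
  "real^'q^'q^'p \<Rightarrow> (('q::finite, 'p::finite) nil \<Rightarrow> ('q, 'p) nil \<Rightarrow> ('q, 'p) nil \<Rightarrow> real) \<Rightarrow> bool" where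
  "trivial_rym_soliton C h \<longleftrightarrow> (\<exists>c. rym_soliton_eqs C h c (\<lambda>_. 0))"

section \<open>Group action and minimal points\<close>

definition gl_act :: "real^'q^'q \<Rightarrow> real^'q^'q^'p \<Rightarrow> real^'q::finite^'q^'p::finite" where
  "gl_act a C = (\<chi> k. a ** (C $ k) ** transpose a)"

definition gl_inf_act :: "real^'q^'q \<Rightarrow> real^'q^'q^'p \<Rightarrow> real^'q::finite^'q^'p::finite" where
  "gl_inf_act X C = (\<chi> k. X ** (C $ k) + (C $ k) ** transpose X)"

definition sl_orbit :: "real^'q^'q^'p \<Rightarrow> (real^'q::finite^'q^'p::finite) set" where
  "sl_orbit C = {gl_act a C | a. det a = 1}"

definition moment_gl :: "real^'q^'q^'p \<Rightarrow> real^'q::finite^'q" where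
  "moment_gl C = (- 2) *\<^sub>R (\<Sum>k\<in>UNIV. (C $ (k::'p::finite)) ** (C $ k))"

definition moment_sl :: "real^'q^'q^'p::finite \<Rightarrow> real^'q::finite^'q" where
  "moment_sl C = moment_gl C - (trace (moment_gl C) / real CARD('q)) *\<^sub>R mat 1"

definition sl_minimal :: "real^'q^'q^'p::finite \<Rightarrow> bool" where
  "sl_minimal (C :: real^'q::finite^'q^'p) \<longleftrightarrow> gl_inf_act (moment_sl C) C = 0"

text \<open>A property of the left-invariant metric attached to \<open>C\<close>, that is of \<^term>\<open>std_metric C\<close>.\<close>

definition geodesically_flow_invariant :: "real^'q^'q^'p::finite \<Rightarrow> bool" where
  "geodesically_flow_invariant (C :: real^'q::finite^'q^'p) \<longleftrightarrow> sl_minimal C"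

section \<open>Consistency of the model\<close>

lemma lie_bracket_alt: "lie_bracket C u v = (0, \<chi> k. fst u \<bullet> (C $ k *v fst v))"
  unfolding lie_bracket_def inner_vec_def matrix_vector_mult_def
  by (auto simp: sum_distrib_left vec_eq_iff intro!: sum.cong)

lemma bilinear_lie_bracket: "bilinear (lie_bracket C)"
  unfolding bilinear_def lie_bracket_alt
  by (intro conjI allI linearI; simp only: prod_eq_iff fst_add snd_add fst_scaleR snd_scaleR
      fst_conv snd_conv vec_eq_iff vector_add_component vector_scaleR_component vec_lambda_beta
      inner_simps matrix_vector_right_distrib matrix_vector_mult_scaleR; simp)

lemma lie_bracket_skew:
  assumes "C \<in> so_tuples" shows "lie_bracket C u v = - lie_bracket C v u"
proof -
  have "x \<bullet> (C $ k *v y) = - (y \<bullet> (C $ k *v x))" for x y k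
  proof -
    have "x \<bullet> (C $ k *v y) = (transpose (C $ k) *v x) \<bullet> y"
      by (metis dot_lmul_matrix transpose_matrix_vector)
    also have "transpose (C $ k) = - (C $ k)" using assms by (simp add: so_tuples_def)
    finally show ?thesis
      by (simp add: inner_commute matrix_vector_mult_def inner_vec_def sum_negf)
  qed
  note * = this
  have "(\<chi> k. fst u \<bullet> (C $ k *v fst v)) = - (\<chi> k. fst v \<bullet> (C $ k *v fst u))"
    unfolding vec_eq_iff vector_uminus_component vec_lambda_beta by (intro allI *)
  then show ?thesis unfolding lie_bracket_alt by (simp only: uminus_Pair minus_zero)
qed

lemma fst_lie_bracket [simp]: "fst (lie_bracket C u v) = 0"
  by (simp add: lie_bracket_def)

lemma fst_lie_mult [simp]: "fst (lie_mult C a x) = fst a + fst x"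
  by (simp add: lie_mult_def)

lemma lie_bracket_vert [simp]: "fst v = 0 \<Longrightarrow> lie_bracket C u v = 0" 
  "fst u = 0 \<Longrightarrow> lie_bracket C u v = 0"
  by (simp_all add: lie_bracket_def zero_prod_def vec_eq_iff)

lemmas lie_bracket_simps =
  bilinear_ladd[OF bilinear_lie_bracket] bilinear_radd[OF bilinear_lie_bracket]
  bilinear_lmul[OF bilinear_lie_bracket] bilinear_rmul[OF bilinear_lie_bracket]
  bilinear_lneg[OF bilinear_lie_bracket] bilinear_rneg[OF bilinear_lie_bracket]
  bilinear_lsub[OF bilinear_lie_bracket] bilinear_rsub[OF bilinear_lie_bracket]

lemma lie_mult_assoc: "lie_mult C (lie_mult C a b) c = lie_mult C a (lie_mult C b c)"
  by (simp add: lie_mult_def lie_bracket_simps scaleR_add_right)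

lemma lie_mult_zero: "lie_mult C 0 a = a" "lie_mult C a 0 = a"
  by (simp_all add: lie_mult_def)

lemma lie_mult_inverse:
  assumes "C \<in> so_tuples" shows "lie_mult C (- a) a = 0" "lie_mult C a (- a) = 0"
proof -
  have "2 *\<^sub>R lie_bracket C a a = 0"
    using lie_bracket_skew[OF assms, of a a] unfolding scaleR_2 by (metis add.right_inverse)
  then have "lie_bracket C a a = 0" by simp
  then show "lie_mult C (- a) a = 0" "lie_mult C a (- a) = 0"
    by (simp_all add: lie_mult_def lie_bracket_simps)
qed

lemma has_derivative_lie_bracket:
  "((\<lambda>x. lie_bracket C a x) has_derivative (\<lambda>u. lie_bracket C a u)) (at x)"
  using bilinear_lie_bracket[of C] unfolding bilinear_def by (blast intro: linear_imp_has_derivative)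

lemma transl_diff_eq: "transl_diff C a x u = u + (1/2) *\<^sub>R lie_bracket C a u"
proof -
  have "((\<lambda>x. a + x + (1/2) *\<^sub>R lie_bracket C a x) has_derivative
     (\<lambda>u. 0 + u + (1/2) *\<^sub>R lie_bracket C a u)) (at x)"
    by (intro derivative_intros has_derivative_lie_bracket)
  then have "(lie_mult C a has_derivative (\<lambda>u. u + (1/2) *\<^sub>R lie_bracket C a u)) (at x)"
    by (simp add: lie_mult_def[abs_def])
  from frechet_derivative_at[OF this] show ?thesis
    unfolding transl_diff_def by metis
qed

text \<open>The Lie bracket of the left-invariant vector fields extending \<open>u\<close> and \<open>v\<close>.\<close>

lemma left_invariant_fields_bracket:
  assumes "C \<in> so_tuples"
  shows "frechet_derivative (\<lambda>n. transl_diff C n 0 v) (at n) (transl_diff C n 0 u) -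
         frechet_derivative (\<lambda>n. transl_diff C n 0 u) (at n) (transl_diff C n 0 v) =
         transl_diff C n 0 (lie_bracket C u v)"
proof -
  have lin: "linear (\<lambda>x. lie_bracket C x a)" for a
    using bilinear_lie_bracket[of C] unfolding bilinear_def by blast
  have "((\<lambda>n. a + (1/2) *\<^sub>R lie_bracket C n a) has_derivative
     (\<lambda>w. 0 + (1/2) *\<^sub>R lie_bracket C w a)) (at n)" for a
    by (intro derivative_intros linear_imp_has_derivative[OF lin])
  then have "frechet_derivative (\<lambda>n. transl_diff C n 0 a) (at n) w = (1/2) *\<^sub>R lie_bracket C w a"
    for a w
    unfolding transl_diff_eq by (subst frechet_derivative_at[symmetric]) auto
  then show ?thesis
    using lie_bracket_skew[OF assms, of v u]
    by (simp add: transl_diff_eq lie_bracket_simps flip: scaleR_add_left)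
qed

lemma derived_algebra_eq:
  fixes C :: "real^'q^'q^'p"
  assumes "lin_indep_tuple C" shows "derived_algebra C = {0} \<times> UNIV"
proof -
  let ?S = "{lie_bracket C u v | u v. True}"
  let ?T = "snd ` ?S"
  have "span ?T = UNIV"
  proof (rule ccontr)
    assume "span ?T \<noteq> UNIV"
    then obtain w where w: "w \<noteq> 0" "\<And>x. x \<in> span ?T \<Longrightarrow> w \<bullet> x = 0"
      using span_not_UNIV_orthogonal[of ?T] by auto
    have "(\<Sum>k\<in>UNIV. w $ k *\<^sub>R (C $ k)) $ i $ j = 0" for i j
    proof -
      have "snd (lie_bracket C (axis i 1, 0) (axis j 1, 0)) \<in> span ?T"
        by (intro span_base) blast
      moreover have "snd (lie_bracket C (axis i 1, 0) (axis j 1, 0)) = (\<chi> k. C $ k $ i $ j)"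
        by (simp add: lie_bracket_alt inner_axis' matrix_vector_mult_basis column_def)
      ultimately show ?thesis using w(2) by (fastforce simp: inner_vec_def)
    qed
    then have "(\<Sum>k\<in>UNIV. w $ k *\<^sub>R (C $ k)) = 0" by (simp add: vec_eq_iff)
    then have "w = 0" using assms by (auto simp: lin_indep_tuple_def vec_eq_iff)
    with w show False by simp
  qed
  moreover have "?S = (\<lambda>z. (0, z)) ` ?T"
  proof -
    have "(0, snd x) = x" if "x \<in> ?S" for x using that unfolding lie_bracket_def by force
    then show ?thesis by (simp only: image_image) simp
  qed
  moreover have "linear (\<lambda>z::real^'p. (0::real^'q, z))" by (intro linearI) simp_all
  ultimately have "span ?S = (\<lambda>z. (0, z)) ` UNIV"
    using linear_span_image[of "\<lambda>z::real^'p. (0::real^'q, z)" ?T] by simp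
  then show ?thesis unfolding derived_algebra_def by auto
qed

lemma fst_eq_iff_coset:
  assumes "lin_indep_tuple C"
  shows "fst m = fst n \<longleftrightarrow> (\<exists>z\<in>derived_algebra C. m = lie_mult C n z)"
proof
  assume "fst m = fst n"
  then have "m = lie_mult C n (0, snd m - snd n)"
    by (simp add: lie_mult_def prod_eq_iff)
  then show "\<exists>z\<in>derived_algebra C. m = lie_mult C n z"
    unfolding derived_algebra_eq[OF assms] by blast
qed (auto simp: derived_algebra_eq[OF assms])

lemma left_invariant_std_metric:
  assumes "C \<in> so_tuples" shows "left_invariant_metric C (std_metric C)"
proof -
  have inj: "transl_diff C (- n) n u = 0 \<longleftrightarrow> u = 0" for n u
  proof
    assume *: "transl_diff C (- n) n u = 0"
    then have "fst (transl_diff C (- n) n u) = 0" by simp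
    then have "fst u = 0" by (simp add: transl_diff_eq)
    then show "u = 0" using * by (simp add: transl_diff_eq)
  qed (simp add: transl_diff_eq)
  have lin: "transl_diff C a n (u + v) = transl_diff C a n u + transl_diff C a n v"
    "transl_diff C a n (r *\<^sub>R u) = r *\<^sub>R transl_diff C a n u" for a n u v r
    by (simp_all add: transl_diff_eq lie_bracket_simps scaleR_add_right)
  have "inner_product (std_metric C n)" for n
    unfolding inner_product_def bilinear_def std_metric_def
    by (intro conjI allI linearI impI)
       (simp_all only: inj inner_gt_zero_iff inner_commute lin inner_simps real_scaleR_def
          not_False_eq_True)
  moreover have "transl_diff C (- lie_mult C a n) (lie_mult C a n) (transl_diff C a n u) =
                 transl_diff C (- n) n u" for a n u
    by (simp add: transl_diff_eq lie_bracket_simps lie_mult_def flip: scaleR_add_right scaleR_minus_right)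
  ultimately show ?thesis
    by (simp add: left_invariant_metric_def std_metric_def)
qed

text \<open>The definite descriptions in the bundle data denote: lemmas \<open>ex1_connection\<close>,
  \<open>ex1_base_curvature\<close> and \<open>ex1_base_metric\<close>.\<close>

lemma horizontal_eq:
  assumes "lin_indep_tuple C"
  shows "horizontal C h n = {u. \<forall>z. h n u (0, z) = 0}"
  by (auto simp: horizontal_def derived_algebra_eq[OF assms] transl_diff_eq)

lemma vertical_projection:
  fixes C :: "real^'q^'q^'p"
  assumes "inner_product (b :: ('q, 'p) nil \<Rightarrow> _)"
  obtains P :: "real^'q \<Rightarrow> real^'p" where "linear P"
    and "\<And>u. (\<forall>z. b u (0, z) = 0) \<longleftrightarrow> snd u = P (fst u)"
proof -
  have bil: "bilinear b" and sym: "\<And>u v. b u v = b v u" and pos: "\<And>u. u \<noteq> 0 \<Longrightarrow> b u u > 0"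
    using assms by (auto simp: inner_product_def)
  note bs = bilinear_ladd[OF bil] bilinear_radd[OF bil] bilinear_lmul[OF bil]
    bilinear_rmul[OF bil] bilinear_lsub[OF bil] bilinear_rsub[OF bil] bilinear_lzero[OF bil]
  have vert: "(0::real^'q, x + y) = (0, x) + (0, y)" "(0::real^'q, r *\<^sub>R x) = r *\<^sub>R (0, x)"
    for x y :: "real^'p" and r by simp_all
  define F where "F u = (\<chi> i. b u (0, axis i 1))" for u
  have linF: "linear F"
    by (rule linearI) (simp_all add: F_def vec_eq_iff bs)
  have F0: "F u = 0 \<longleftrightarrow> (\<forall>z. b u (0, z) = 0)" for u
  proof
    assume "F u = 0"
    then have 1: "b u (0, axis i 1) = 0" for i by (simp add: F_def vec_eq_iff)
    have lin: "linear (\<lambda>z. b u (0, z))"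
      by (rule linearI) (simp_all only: vert bs real_scaleR_def)
    show "\<forall>z. b u (0, z) = 0"
    proof
      fix z
      have "b u (0, z) = b u (0, \<Sum>i\<in>UNIV. z $ i *\<^sub>R axis i 1)"
        using basis_expansion[of z] by (simp add: scalar_mult_eq_scaleR)
      also have "\<dots> = (\<Sum>i\<in>UNIV. z $ i *\<^sub>R b u (0, axis i 1))"
        by (subst linear_sum[OF lin]) (simp add: linear_scale[OF lin, unfolded real_scaleR_def])
      finally show "b u (0, z) = 0" using 1 by simp
    qed
  qed (simp add: F_def vec_eq_iff)
  define V where "V z = F (0, z)" for z
  have linV: "linear V"
    unfolding V_def by (rule linearI) (simp_all only: vert linear_add[OF linF] linear_scale[OF linF])
  have "inj V"
  proof (rule linear_injective_0[OF linV, THEN iffD2], intro allI impI)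
    fix z assume "V z = 0"
    then have "b (0, z) (0, z) = 0" by (simp add: V_def F0)
    then show "z = 0" using pos[of "(0, z)"] by (auto simp: prod_eq_iff)
  qed
  then obtain G where G: "linear G" "\<And>x. G (V x) = x" "\<And>x. V (G x) = x"
    using linear_injective_isomorphism[OF linV] by blast
  define P where "P x = G (- F (x, 0))" for x
  have "linear P"
  proof (rule linearI)
    fix x y r
    have "F (x + y, 0) = F (x, 0) + F (y, 0)" "F (r *\<^sub>R x, 0) = r *\<^sub>R F (x, 0)"
      using linear_add[OF linF, of "(x, 0)" "(y, 0)"] linear_scale[OF linF, of r "(x, 0)"] by simp_all
    then show "P (x + y) = P x + P y" "P (r *\<^sub>R x) = r *\<^sub>R P x"
      by (simp_all add: P_def linear_diff[OF G(1)] linear_neg[OF G(1)] linear_add[OF G(1)] linear_scale[OF G(1)])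
  qed
  moreover have "(\<forall>z. b u (0, z) = 0) \<longleftrightarrow> snd u = P (fst u)" for u
  proof -
    have "F u = F (fst u, 0) + V (snd u)"
      using linear_add[OF linF, of "(fst u, 0)" "(0, snd u)"] by (simp add: V_def)
    then have "F u = 0 \<longleftrightarrow> V (snd u) = - F (fst u, 0)"
      by (simp add: eq_neg_iff_add_eq_0 add.commute)
    also have "\<dots> \<longleftrightarrow> snd u = P (fst u)"
      unfolding P_def by (metis G(2,3))
    finally show ?thesis by (simp add: F0)
  qed
  ultimately show ?thesis by (rule that)
qed

lemma bundle_data_normal_form:
  fixes C :: "real^'q^'q^'p"
  assumes C: "C \<in> so_tuples" "lin_indep_tuple C" and h: "left_invariant_metric C h"
  obtains P :: "real^'q \<Rightarrow> real^'p" where "linear P"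
    and "\<forall>n. horizontal C h n = {u. snd u = (1/2) *\<^sub>R snd (lie_bracket C n u) + P (fst u)}"
    and "\<forall>n u v. h n u v = h 0 (u - (1/2) *\<^sub>R lie_bracket C n u) (v - (1/2) *\<^sub>R lie_bracket C n v)"
proof -
  have "inner_product (h 0)" using h unfolding left_invariant_metric_def by blast
  then obtain P where P: "linear P" "\<And>u. (\<forall>z. h 0 u (0, z) = 0) \<longleftrightarrow> snd u = P (fst u)"
    using vertical_projection by blast
  have inv: "h n u v = h 0 (u - (1/2) *\<^sub>R lie_bracket C n u) (v - (1/2) *\<^sub>R lie_bracket C n v)"
    for n u v
  proof -
    have "h n u v = h (lie_mult C (- n) n) (transl_diff C (- n) n u) (transl_diff C (- n) n v)"
      using h unfolding left_invariant_metric_def by metis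
    then show ?thesis
      by (simp add: lie_mult_inverse[OF C(1)] transl_diff_eq lie_bracket_simps)
  qed
  have "horizontal C h n = {u. snd u = (1/2) *\<^sub>R snd (lie_bracket C n u) + P (fst u)}" for n
  proof -
    have "u \<in> horizontal C h n \<longleftrightarrow> (\<forall>z. h 0 (u - (1/2) *\<^sub>R lie_bracket C n u) (0, z) = 0)" for u
      by (simp add: horizontal_eq[OF C(2)] inv[of n])
    then show ?thesis unfolding P(2) by (auto simp: algebra_simps)
  qed
  with P(1) inv show ?thesis by (intro that allI)
qed

lemma lie_mult_transl_bracket:
  "lie_bracket C (lie_mult C a n) (transl_diff C a n u) = lie_bracket C a u + lie_bracket C n u"
  by (simp add: lie_mult_def transl_diff_eq lie_bracket_simps)

lemma connection_normal_form:
  fixes C :: "real^'q^'q^'p"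
  assumes C: "C \<in> so_tuples" "lin_indep_tuple C" and h: "left_invariant_metric C h"
    and P: "linear P" "\<And>n. horizontal C h n =
              {u. snd u = (1/2) *\<^sub>R snd (lie_bracket C n u) + P (fst u)}"
  shows "is_connection C h \<omega> \<longleftrightarrow>
         \<omega> = (\<lambda>n u. snd u - (1/2) *\<^sub>R snd (lie_bracket C n u) - P (fst u))" (is "_ \<longleftrightarrow> \<omega> = ?w")
proof
  have P0: "P 0 = 0" by (rule linear_0[OF P(1)])
  assume \<omega>: "is_connection C h \<omega>"
  show "\<omega> = ?w"
  proof (intro ext)
    fix n u
    have lin: "linear (\<omega> n)" and vert: "\<omega> n (0, z) = z" for z
      using \<omega> by (simp_all add: is_connection_def transl_diff_eq del: split_paired_All)
    have "u - (0, ?w n u) \<in> horizontal C h n"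
      by (simp add: P(2) lie_bracket_simps)
    then have "\<omega> n (u - (0, ?w n u)) = 0"
      using \<omega> unfolding is_connection_def by blast
    then show "\<omega> n u = ?w n u" by (simp add: linear_diff[OF lin] vert)
  qed
next
  have P0: "P 0 = 0" by (rule linear_0[OF P(1)])
  have lin: "linear (?w n)" for n
    by (rule linearI) (simp_all add: lie_bracket_simps linear_add[OF P(1)] linear_scale[OF P(1)]
        algebra_simps)
  have inv: "?w (lie_mult C a n) (transl_diff C a n u) = ?w n u" for a n u
    unfolding lie_mult_transl_bracket by (simp add: transl_diff_eq scaleR_add_right)
  assume \<omega>: "\<omega> = ?w"
  show "is_connection C h \<omega>"
    unfolding is_connection_def
  proof (intro conjI allI ballI)
    show "\<omega> n u = 0" if "u \<in> horizontal C h n" for n u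
      using that by (simp add: \<omega> P(2))
    show "\<omega> n (transl_diff C n 0 (0, z)) = z" for n z
      by (simp add: \<omega> transl_diff_eq P0)
  qed (simp_all only: \<omega> lin inv)
qed

lemma ex1_connection:
  assumes "C \<in> so_tuples" "lin_indep_tuple C" "left_invariant_metric C h"
  shows "\<exists>!\<omega>. is_connection C h \<omega>"
proof -
  obtain P where P': "linear P"
      "\<forall>n. horizontal C h n = {u. snd u = (1/2) *\<^sub>R snd (lie_bracket C n u) + P (fst u)}"
      "\<forall>n u v. h n u v = h 0 (u - (1/2) *\<^sub>R lie_bracket C n u) (v - (1/2) *\<^sub>R lie_bracket C n v)"
    by (rule bundle_data_normal_form[OF assms])
  note P = P'(1) P'(2)[rule_format] P'(3)[rule_format]
  show ?thesis unfolding connection_normal_form[OF assms P(1,2)] by (rule ex1_eq)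
qed

lemma curvature_eq:
  fixes C :: "real^'q^'q^'p"
  assumes "C \<in> so_tuples" "lin_indep_tuple C" "left_invariant_metric C h"
  shows "curvature C h n u v = - snd (lie_bracket C u v)"
proof -
  obtain P where P': "linear P"
      "\<forall>n. horizontal C h n = {u. snd u = (1/2) *\<^sub>R snd (lie_bracket C n u) + P (fst u)}"
      "\<forall>n u v. h n u v = h 0 (u - (1/2) *\<^sub>R lie_bracket C n u) (v - (1/2) *\<^sub>R lie_bracket C n v)"
    by (rule bundle_data_normal_form[OF assms])
  note P = P'(1) P'(2)[rule_format] P'(3)[rule_format]
  have conn: "connection C h = (\<lambda>n u. snd u - (1/2) *\<^sub>R snd (lie_bracket C n u) - P (fst u))"
    unfolding connection_def connection_normal_form[OF assms P(1,2)] by (rule the_eq_trivial)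
  have lin: "linear (\<lambda>x. lie_bracket C x v)" for v
    using bilinear_lie_bracket[of C] unfolding bilinear_def by blast
  have "((\<lambda>m. snd v - (1/2) *\<^sub>R snd (lie_bracket C m v) - P (fst v)) has_derivative
      (\<lambda>w. 0 - (1/2) *\<^sub>R snd (lie_bracket C w v) - 0)) (at n)" for v
    by (intro derivative_intros linear_imp_has_derivative[OF lin])
  from frechet_derivative_at[OF this, symmetric]
  have "frechet_derivative (\<lambda>m. connection C h m v) (at n) u = - (1/2) *\<^sub>R snd (lie_bracket C u v)"
    for u v by (simp add: conn)
  then show ?thesis
    using lie_bracket_skew[OF assms(1), of v u]
    by (simp add: curvature_def flip: scaleR_add_left)
qed

lemma ex1_base_curvature:
  fixes C :: "real^'q^'q^'p"
  assumes "C \<in> so_tuples" "lin_indep_tuple C" "left_invariant_metric C h"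
  shows "\<exists>!W. \<forall>n u v. W (fst n) (fst u) (fst v) = curvature C h n u v"
proof (rule ex1I)
  let ?W = "\<lambda>x a b. - snd (lie_bracket C (a, 0) (b, 0))"
  show "\<forall>n u v. ?W (fst n) (fst u) (fst v) = curvature C h n u v"
    by (simp add: curvature_eq[OF assms] lie_bracket_def)
  fix W assume W: "\<forall>n u v. W (fst n) (fst u) (fst v) = curvature C h n u v"
  show "W = ?W"
  proof (intro ext)
    fix x a b
    show "W x a b = ?W x a b"
      using W[rule_format, of "(x, 0)" "(a, 0)" "(b, 0)"] by (simp add: curvature_eq[OF assms])
  qed
qed

lemma ex1_base_metric:
  fixes C :: "real^'q^'q^'p"
  assumes "C \<in> so_tuples" "lin_indep_tuple C" "left_invariant_metric C h"
  shows "\<exists>!g. \<forall>n. \<forall>u\<in>horizontal C h n. \<forall>v\<in>horizontal C h n. g (fst n) (fst u) (fst v) = h n u v"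
proof -
  obtain P where P': "linear P"
      "\<forall>n. horizontal C h n = {u. snd u = (1/2) *\<^sub>R snd (lie_bracket C n u) + P (fst u)}"
      "\<forall>n u v. h n u v = h 0 (u - (1/2) *\<^sub>R lie_bracket C n u) (v - (1/2) *\<^sub>R lie_bracket C n v)"
    by (rule bundle_data_normal_form[OF assms])
  note P = P'(1) P'(2)[rule_format] P'(3)[rule_format]
  have shift: "u - (1/2) *\<^sub>R lie_bracket C n u = (fst u, P (fst u))"
    if "u \<in> horizontal C h n" for n u
    using that by (simp add: P(2) prod_eq_iff)
  let ?g = "\<lambda>x a b. h 0 (a, P a) (b, P b)"
  show ?thesis
  proof (rule ex1I)
    show "\<forall>n. \<forall>u\<in>horizontal C h n. \<forall>v\<in>horizontal C h n. ?g (fst n) (fst u) (fst v) = h n u v"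
      by (intro allI ballI, subst P(3)) (simp add: shift)
    fix g assume g: "\<forall>n. \<forall>u\<in>horizontal C h n. \<forall>v\<in>horizontal C h n. g (fst n) (fst u) (fst v) = h n u v"
    show "g = ?g"
    proof (intro ext)
      fix x a b :: "real^'q"
      let ?n = "(x, 0 :: real^'p)" and ?l = "\<lambda>a. (a, (1/2) *\<^sub>R snd (lie_bracket C (x, 0) (a, 0)) + P a)"
      have l: "?l a \<in> horizontal C h ?n" for a :: "real^'q" by (simp add: P(2) lie_bracket_def)
      have "g (fst ?n) (fst (?l a)) (fst (?l b)) = h ?n (?l a) (?l b)"
        by (rule g[rule_format, OF l l])
      also have "\<dots> = ?g x a b" by (subst P(3)) (simp only: shift[OF l] fst_conv)
      finally show "g x a b = ?g x a b" by simp
    qed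
  qed
qed

end

theory Submission
  imports Defs
begin

text \<open>The base metric and the curvature form of these left-invariant metrics have constant
  coefficients, so the soliton equations with vanishing field say only that \<open>\<Omega>\<^sup>2\<close> is a multiple
  of the base metric, that is, that the moment map of the tuple is a scalar matrix. If
  \<open>M\<close> is the trace-free moment map and \<open>M\<close> annihilates \<open>C\<close>, then pairing with \<open>C\<close> gives
  \<open>tr M\<^sup>2 = 0\<close>; this settles the second part. For the first part, a point of minimal norm of the
  closed orbit is critical along the one-parameter groups \<open>1 + t v w\<^sup>t\<close> with \<open>v\<close> and \<open>w\<close>
  orthogonal, which forces a scalar moment map; the standard metric at that point is pulled back
  to the group of \<open>C\<close>.\<close>

section \<open>Matrices\<close>

lemma bounded_bilinear_matrix_mult:
  "bounded_bilinear ((**) :: real^'n^'m \<Rightarrow> real^'k^'n \<Rightarrow> real^'k^'m)"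
  unfolding bilinear_conv_bounded_bilinear[symmetric] bilinear_def
  by (intro conjI allI linearI)
     (simp_all add: matrix_matrix_mult_def vec_eq_iff sum.distrib sum_distrib_left algebra_simps)

lemmas matrix_mult_bilinear =
  bounded_bilinear.add_left[OF bounded_bilinear_matrix_mult]
  bounded_bilinear.add_right[OF bounded_bilinear_matrix_mult]
  bounded_bilinear.diff_left[OF bounded_bilinear_matrix_mult]
  bounded_bilinear.diff_right[OF bounded_bilinear_matrix_mult]
  bounded_bilinear.minus_left[OF bounded_bilinear_matrix_mult]
  bounded_bilinear.minus_right[OF bounded_bilinear_matrix_mult]
  bounded_bilinear.scaleR_left[OF bounded_bilinear_matrix_mult]
  bounded_bilinear.scaleR_right[OF bounded_bilinear_matrix_mult]

lemmas matrix_mult_sum_left = bounded_bilinear.sum_left[OF bounded_bilinear_matrix_mult]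
lemmas matrix_mult_sum_right = bounded_bilinear.sum_right[OF bounded_bilinear_matrix_mult]

lemma transpose_add: "transpose (A + B) = transpose A + transpose B"
  by (simp add: transpose_def vec_eq_iff)

lemma transpose_uminus: "transpose (- A) = - transpose (A :: real^'n^'m)"
  by (simp add: transpose_def vec_eq_iff)

lemma transpose_sum: "transpose (\<Sum>k\<in>K. A k) = (\<Sum>k\<in>K. transpose (A k))"
  by (simp add: transpose_def vec_eq_iff)

lemma trace_uminus: "trace (- A) = - trace (A :: real^'n^'n)"
  by (simp add: trace_def sum_negf)

lemma trace_scaleR: "trace (r *\<^sub>R A) = r * trace (A :: real^'n^'n)"
  by (simp add: trace_def sum_distrib_left)

lemma trace_sum: "trace (\<Sum>k\<in>K. A k) = (\<Sum>k\<in>K. trace (A k :: real^'n^'n))"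
  unfolding trace_def by (simp add: sum.swap[of _ K])

lemma inner_eq_trace: "A \<bullet> B = trace (transpose A ** B)" for A B :: "real^'n^'m"
proof -
  have "A \<bullet> B = (\<Sum>i\<in>UNIV. \<Sum>j\<in>UNIV. A $ i $ j * B $ i $ j)"
    by (simp add: inner_vec_def)
  also have "\<dots> = (\<Sum>j\<in>UNIV. \<Sum>i\<in>UNIV. A $ i $ j * B $ i $ j)"
    by (rule sum.swap)
  finally show ?thesis
    by (simp add: trace_def matrix_matrix_mult_def transpose_def)
qed

lemma matrix_inv_eqI:
  fixes A B :: "real^'n^'n"
  assumes "A ** B = mat 1"
  shows "matrix_inv A = B"
proof -
  have BA: "B ** A = mat 1" using assms by (simp add: matrix_left_right_inverse)
  have "\<exists>A'. A ** A' = mat 1 \<and> A' ** A = mat 1" using assms BA by blast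
  then have "A ** matrix_inv A = mat 1"
    unfolding matrix_inv_def by (rule someI2_ex) blast
  then have "B ** (A ** matrix_inv A) = B" by simp
  then show ?thesis by (simp add: matrix_mul_assoc BA)
qed

section \<open>Determinants of rank-one perturbations of the identity\<close>

lemma det_transvection:
  fixes i j :: "'n::finite"
  assumes "i \<noteq> j"
  shows "det (mat 1 + t *\<^sub>R (\<chi> a b. axis i 1 $ a * axis j 1 $ b) :: real^'n^'n) = 1"
proof -
  have "(mat 1 + t *\<^sub>R (\<chi> a b. axis i 1 $ a * axis j 1 $ b) :: real^'n^'n) =
    (\<chi> k. if k = i then row i (mat 1) + t *s row j (mat 1) else row k (mat 1))"
    by (auto simp: vec_eq_iff mat_def row_def axis_def)
  also have "det \<dots> = 1" by (simp only: det_row_operation[OF assms] det_I)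
  finally show ?thesis .
qed

text \<open>Since \<open>N\<^sup>2 = 0\<close>, the matrix \<open>1 + tN\<close> is the square of \<open>1 + (t/2)N\<close> and the inverse of
  \<open>1 - tN\<close>, to which it is conjugate by the transposition of \<open>i\<close> and \<open>j\<close>.\<close>

lemma det_sym_transvection:
  fixes i j :: "'n::finite" and t :: real
  assumes "i \<noteq> j"
  defines "N \<equiv> (\<chi> a b. (axis i 1 + axis j 1) $ a * (axis i 1 - axis j 1) $ b) :: real^'n^'n"
  shows "det (mat 1 + t *\<^sub>R N) = 1"
proof -
  let ?v = "axis i 1 + axis j 1 :: real^'n" and ?w = "axis i 1 - axis j 1 :: real^'n"
  let ?p = "Transposition.transpose i j"
  have p: "?p permutes (UNIV :: 'n set)" by (simp add: permutes_swap_id)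
  have "?w \<bullet> ?v = 0"
    using assms(1) by (simp add: inner_simps inner_axis_axis)
  then have wv: "(\<Sum>c\<in>UNIV. ?w $ c * ?v $ c) = 0" by (simp only: inner_vec_def inner_real_def)
  have "(N ** N) $ a $ b = ?v $ a * (\<Sum>c\<in>UNIV. ?w $ c * ?v $ c) * ?w $ b" for a b
    unfolding N_def matrix_matrix_mult_def sum_distrib_left sum_distrib_right
    by (simp add: mult_ac)
  then have NN: "N ** N = 0"
    by (simp only: wv vec_eq_iff mult_zero_left mult_zero_right zero_index) blast
  have mult: "(mat 1 + s *\<^sub>R N) ** (mat 1 + r *\<^sub>R N) = mat 1 + (s + r) *\<^sub>R N" for s r
    by (simp add: matrix_mult_bilinear NN scaleR_add_left)
  \<comment> \<open>Swapping \<open>i\<close> and \<open>j\<close> fixes \<open>?v\<close> and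
    negates \<open>?w\<close>, hence sends \<open>N\<close> to \<open>- N\<close>; the two
    permutation signs cancel in the determinant.\<close>
  have vp: "?v $ ?p a = ?v $ a" and wp: "?w $ ?p a = - ?w $ a" for a
    using assms(1) by (auto simp: axis_def Transposition.transpose_def)
  have "N $ ?p a $ ?p b = - N $ a $ b" for a b
    by (simp only: N_def vec_lambda_beta vp wp mult_minus_right)
  moreover have "(mat 1 :: real^'n^'n) $ ?p a $ ?p b = mat 1 $ a $ b" for a b
    by (simp add: mat_def inj_eq[OF permutes_inj[OF p]])
  ultimately have "mat 1 + (- s) *\<^sub>R N = (\<chi> a b. (\<chi> a. (mat 1 + s *\<^sub>R N) $ ?p a) $ a $ ?p b)" for s
    by (simp add: vec_eq_iff)
  then have "det (mat 1 + (- s) *\<^sub>R N) = of_int (sign ?p) * (of_int (sign ?p) * det (mat 1 + s *\<^sub>R N))" for s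
    by (simp only: det_permute_columns[OF p] det_permute_rows[OF p])
  then have neg: "det (mat 1 + (- s) *\<^sub>R N) = det (mat 1 + s *\<^sub>R N)" for s
    by (simp add: sign_def)
  have "det (mat 1 + (- t) *\<^sub>R N) * det (mat 1 + t *\<^sub>R N) = 1"
    using mult[of "- t" t] by (simp flip: det_mul)
  then have "(det (mat 1 + t *\<^sub>R N))\<^sup>2 = 1" by (simp only: neg power2_eq_square)
  \<comment> \<open>The determinant is now 1 or -1; being the square of a real number, it is not
    -1.\<close>
  moreover have "det (mat 1 + t *\<^sub>R N) = (det (mat 1 + (t/2) *\<^sub>R N))\<^sup>2"
    using mult[of "t/2" "t/2"] by (simp flip: det_mul add: power2_eq_square)
  then have "det (mat 1 + t *\<^sub>R N) \<ge> 0" by simp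
  ultimately show ?thesis by (simp add: power2_eq_1_iff)
qed

section \<open>Minimal points and the moment map\<close>

lemma gl_act_mult: "gl_act a (gl_act b C) = gl_act (a ** b) C"
  by (simp add: gl_act_def vec_eq_iff matrix_transpose_mul matrix_mul_assoc)

lemma gl_act_mat_1: "gl_act (mat 1) C = C"
  by (simp add: gl_act_def vec_eq_iff)

lemma gl_act_so_tuples:
  assumes "C \<in> so_tuples" shows "gl_act a C \<in> so_tuples"
  using assms by (simp add: so_tuples_def gl_act_def matrix_transpose_mul matrix_mult_bilinear matrix_mul_assoc)

text \<open>The action is quadratic in the matrix, so this curve is an exact polynomial in
  \<open>t\<close> whose linear coefficient is the infinitesimal action.\<close>

lemma gl_act_unipotent:
  "gl_act (mat 1 + t *\<^sub>R N) D = D + t *\<^sub>R gl_inf_act N D + t\<^sup>2 *\<^sub>R gl_act N D"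
  unfolding vec_eq_iff[of "gl_act _ _"]
  by (simp add: gl_act_def gl_inf_act_def transpose_add transpose_scalar
      matrix_mult_bilinear scaleR_add_right power2_eq_square)

lemma transpose_moment_gl:
  assumes "D \<in> so_tuples" shows "transpose (moment_gl D) = moment_gl D"
  using assms unfolding moment_gl_def transpose_scalar transpose_sum matrix_transpose_mul
  by (simp add: so_tuples_def matrix_mult_bilinear)

text \<open>The defining property of a moment map: the left side is half the derivative of the
  squared norm at \<open>D\<close> in the direction \<open>X\<close>. Both summands of
  \<open>gl_inf_act\<close> contribute equally, because a matrix and its transpose have the same
  trace.\<close>

lemma inner_gl_inf_act:
  assumes "D \<in> so_tuples"
  shows "D \<bullet> gl_inf_act X D = trace (X ** moment_gl D)"
proof -
  have sk: "transpose (D $ k) = - (D $ k)" for k using assms by (simp add: so_tuples_def)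
  have "D $ k \<bullet> (X ** D $ k + D $ k ** transpose X) = - 2 * trace (X ** (D $ k ** D $ k))" for k
  proof -
    have "trace (D $ k ** (D $ k ** transpose X)) = trace (transpose (D $ k ** (D $ k ** transpose X)))"
      by (simp add: trace_def transpose_def)
    also have "\<dots> = trace (X ** (D $ k ** D $ k))"
      by (simp add: matrix_transpose_mul sk matrix_mult_bilinear matrix_mul_assoc)
    finally have 1: "trace (D $ k ** (D $ k ** transpose X)) = trace (X ** (D $ k ** D $ k))" .
    have 2: "trace (D $ k ** (X ** D $ k)) = trace (X ** (D $ k ** D $ k))"
      by (subst trace_mul_sym) (simp add: matrix_mul_assoc)
    show ?thesis
      by (simp add: inner_eq_trace sk matrix_mult_bilinear trace_add trace_sub trace_uminus 1 2)
  qed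
  then show ?thesis
    unfolding inner_vec_def[of D] gl_inf_act_def moment_gl_def
    by (simp add: matrix_mult_bilinear matrix_mult_sum_right trace_scaleR trace_sum sum_distrib_left trace_uminus sum_negf)
qed

lemma moment_sl_eq_0_iff: "moment_sl D = 0 \<longleftrightarrow> (\<exists>c. moment_gl D = c *\<^sub>R mat 1)"
proof
  assume "\<exists>c. moment_gl D = c *\<^sub>R mat 1"
  then show "moment_sl D = 0" by (auto simp: moment_sl_def trace_scaleR trace_I)
qed (auto simp: moment_sl_def)

lemma sl_minimal_iff_moment_scalar:
  assumes "D \<in> so_tuples"
  shows "sl_minimal D \<longleftrightarrow> (\<exists>c. moment_gl D = c *\<^sub>R mat 1)"
proof -
  have "moment_sl D = 0" if "sl_minimal D"
  proof -
    let ?M = "moment_sl D"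
    have tr: "transpose ?M = ?M"
      by (simp add: moment_sl_def diff_conv_add_uminus transpose_add transpose_uminus transpose_scalar
          transpose_moment_gl[OF assms] del: add_uminus_conv_diff)
    have "trace ?M = 0" by (simp add: moment_sl_def trace_sub trace_scaleR trace_I)
    moreover have "trace (?M ** moment_gl D) = 0"
      using that inner_gl_inf_act[OF assms, of ?M] by (simp add: sl_minimal_def)
    \<comment> \<open>\<open>?M\<close> and \<open>moment_gl D\<close> differ by a scalar matrix,
      whose contribution vanishes as \<open>trace ?M = 0\<close>. For symmetric \<open>?M\<close>
      the trace of the square is the squared norm.\<close>
    moreover have "?M ** ?M = ?M ** moment_gl D - (trace (moment_gl D) / real CARD('a)) *\<^sub>R ?M"
      by (subst (2) moment_sl_def) (simp add: matrix_mult_bilinear)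
    ultimately have "trace (?M ** ?M) = 0" by (simp add: trace_sub trace_scaleR)
    then have "?M \<bullet> ?M = 0" by (simp add: inner_eq_trace tr)
    then show ?thesis by simp
  qed
  moreover have "sl_minimal D" if "moment_sl D = 0"
    using that by (simp add: sl_minimal_def gl_inf_act_def vec_eq_iff transpose_def matrix_matrix_mult_def)
  ultimately show ?thesis unfolding moment_sl_eq_0_iff[symmetric] by blast
qed

section \<open>Vectors of minimal norm in orbits\<close>

lemma inner_eq_0_if_norm_minimal:
  fixes D L Q :: "'a::real_inner"
  assumes "\<And>t::real. norm D \<le> norm (D + t *\<^sub>R L + t\<^sup>2 *\<^sub>R Q)"
  shows "D \<bullet> L = 0"
proof -
  let ?f = "\<lambda>t::real. (D + t *\<^sub>R L + t\<^sup>2 *\<^sub>R Q) \<bullet> (D + t *\<^sub>R L + t\<^sup>2 *\<^sub>R Q)"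
  have eq: "?f t = D \<bullet> D + 2 * t * (D \<bullet> L) + t\<^sup>2 * (L \<bullet> L + 2 * (D \<bullet> Q)) +
      2 * t^3 * (L \<bullet> Q) + t^4 * (Q \<bullet> Q)" for t
    by (simp add: inner_simps inner_commute algebra_simps power2_eq_square power3_eq_cube power4_eq_xxxx)
  have "(?f has_real_derivative 2 * (D \<bullet> L)) (at 0)"
    unfolding eq by (auto intro!: derivative_eq_intros)
  moreover have "?f 0 \<le> ?f t" for t
    using assms[of t] by (simp add: norm_le)
  ultimately have "2 * (D \<bullet> L) = 0"
    \<comment> \<open>The minimum at 0 is global, so the radius 1 is an arbitrary choice.\<close>
    by (intro DERIV_local_min[of ?f "2 * (D \<bullet> L)" 0 1]) auto
  then show ?thesis by simp
qed

text \<open>For the rank-one direction \<open>v w^t\<close> criticality reads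
  \<open>w \<bullet> (S *v v) = 0\<close>, where \<open>S\<close> is the moment map. Coordinate
  vectors give the off-diagonal entries, sums and differences of two of them compare diagonal
  entries.\<close>

lemma moment_scalar_if_norm_minimal:
  fixes D :: "real^'q^'q^'p"
  assumes "D \<in> so_tuples" and min: "\<And>a. det a = 1 \<Longrightarrow> norm D \<le> norm (gl_act a D)"
  shows "\<exists>c. moment_gl D = c *\<^sub>R mat 1"
proof -
  let ?S = "moment_gl D"
  have crit: "(\<Sum>b\<in>UNIV. \<Sum>a\<in>UNIV. w $ b * ?S $ b $ a * v $ a) = 0"
    if "\<And>t. det (mat 1 + t *\<^sub>R (\<chi> a b. v $ a * w $ b) :: real^'q^'q) = 1" for v w :: "real^'q"
  proof -
    have "D \<bullet> gl_inf_act (\<chi> a b. v $ a * w $ b) D = 0"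
      using min[OF that] unfolding gl_act_unipotent by (rule inner_eq_0_if_norm_minimal)
    then have "trace ((\<chi> a b. v $ a * w $ b) ** ?S) = 0"
      by (simp add: inner_gl_inf_act[OF assms(1)])
    then have "(\<Sum>a\<in>UNIV. \<Sum>b\<in>UNIV. w $ b * ?S $ b $ a * v $ a) = 0"
      by (simp add: trace_def matrix_matrix_mult_def mult_ac)
    then show ?thesis by (subst sum.swap)
  qed
  have ax: "(\<Sum>b\<in>UNIV. \<Sum>a\<in>UNIV. w $ b * ?S $ b $ a * v $ a) = w \<bullet> (?S *v v)" for v w
    by (simp add: inner_vec_def matrix_vector_mult_def sum_distrib_left mult_ac)
  have comp: "axis b 1 \<bullet> (?S *v axis a 1) = ?S $ b $ a" for a b
    by (simp add: inner_axis' matrix_vector_mult_basis column_def)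
  have off: "?S $ j $ i = 0" if "i \<noteq> j" for i j
    using crit[OF det_transvection[OF that]] unfolding ax comp .
  \<comment> \<open>With \<open>v = e_i + e_j\<close> and \<open>w = e_i - e_j\<close> the pairing
    is \<open>S_ii - S_jj\<close> plus off-diagonal terms, already known to vanish.\<close>
  have "?S $ i $ i = ?S $ j $ j" if "i \<noteq> j" for i j
    using crit[OF det_sym_transvection[OF that]] off[of i j] off[of j i] that
    unfolding ax by (simp add: matrix_vector_right_distrib inner_simps comp)
  \<comment> \<open>\<open>undefined\<close> serves as a fixed index with which all others are
    compared.\<close>
  then have diag: "?S $ i $ i = ?S $ undefined $ undefined" for i by metis
  have "?S = (?S $ undefined $ undefined) *\<^sub>R mat 1"
    using off diag by (auto simp: vec_eq_iff mat_def)
  then show ?thesis ..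
qed

lemma closed_so_tuples: "closed (so_tuples :: (real^'q^'q^'p) set)"
proof -
  have "(so_tuples :: (real^'q^'q^'p) set) = (\<Inter>k i j. {C. C $ k $ j $ i = - C $ k $ i $ j})"
    by (auto simp: so_tuples_def vec_eq_iff transpose_def)
  also have "closed \<dots>"
    by (intro closed_INT ballI closed_Collect_eq continuous_intros)
  finally show ?thesis .
qed

lemma closed_orbit_moment_scalar:
  fixes C :: "real^'q^'q^'p"
  assumes C: "C \<in> so_tuples" and "closedin (top_of_set so_tuples) (sl_orbit C)"
  obtains a c where "det a = 1" "moment_gl (gl_act a C) = c *\<^sub>R mat 1"
proof -
  have "closed (sl_orbit C)"
    using assms(2) closed_so_tuples by (rule closedin_closed_trans)
  moreover have "gl_act (mat 1) C \<in> sl_orbit C" unfolding sl_orbit_def by force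
  ultimately obtain D where D: "D \<in> sl_orbit C" "\<And>E. E \<in> sl_orbit C \<Longrightarrow> dist 0 D \<le> dist 0 E"
    using distance_attains_inf[of "sl_orbit C" 0] by blast
  then obtain a where a: "det a = 1" "D = gl_act a C" unfolding sl_orbit_def by blast
  \<comment> \<open>By transitivity \<open>b\<close> moves \<open>D\<close> within the orbit of
    \<open>C\<close>, so \<open>D\<close> is also norm-minimal in its own orbit.\<close>
  have "norm D \<le> norm (gl_act b D)" if "det b = 1" for b
  proof -
    have "gl_act b D \<in> sl_orbit C"
      unfolding sl_orbit_def a(2) gl_act_mult using a(1) that by (force simp: det_mul)
    then show ?thesis using D(2) by fastforce
  qed
  then show ?thesis
    using moment_scalar_if_norm_minimal[of D] gl_act_so_tuples[OF C] a that by blast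
qed

section \<open>A family of left-invariant metrics\<close>

text \<open>If \<open>B\<close> is the inverse of \<open>a\<^sup>t\<close>, then \<open>(x, z) \<mapsto> (Bx, z)\<close> is an isomorphism from the group of
  \<open>C\<close> to the group of \<open>a \<cdot> C\<close>, and this is the pullback of the standard metric.\<close>

definition pullback_metric ::
  "real^'q^'q \<Rightarrow> real^'q^'q^'p \<Rightarrow> ('q::finite, 'p::finite) nil \<Rightarrow> ('q, 'p) nil \<Rightarrow> ('q, 'p) nil \<Rightarrow> real" where
  "pullback_metric B C n u v =
     (B *v fst u) \<bullet> (B *v fst v) + snd (transl_diff C (- n) n u) \<bullet> snd (transl_diff C (- n) n v)"

lemma pullback_metric_mat_1: "pullback_metric (mat 1) C = std_metric C"
  by (intro ext) (simp add: pullback_metric_def std_metric_def inner_prod_def transl_diff_eq)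

text \<open>The value depends on \<open>u\<close> only through
  \<open>transl_diff C (- n) n u\<close>, which is unchanged when \<open>n\<close> and
  \<open>u\<close> are left-translated together. Definiteness holds because the left inverse
  \<open>A\<close> makes \<open>B\<close> injective.\<close>

lemma left_invariant_pullback_metric:
  assumes "A ** B = mat 1"
  shows "left_invariant_metric C (pullback_metric B C)"
proof -
  have B0: "B *v x = 0 \<longleftrightarrow> x = 0" for x
    using assms by (metis matrix_vector_mul_assoc matrix_vector_mul_lid matrix_vector_mult_0_right)
  have lin: "snd (transl_diff C a n (u + v)) = snd (transl_diff C a n u) + snd (transl_diff C a n v)"
    "snd (transl_diff C a n (r *\<^sub>R u)) = r *\<^sub>R snd (transl_diff C a n u)" for a n u v r
    by (simp_all add: transl_diff_eq lie_bracket_simps scaleR_add_right)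
  have pos: "pullback_metric B C n u u > 0" if "u \<noteq> 0" for n u
  proof (cases "fst u = 0")
    case True
    then show ?thesis using that by (simp add: pullback_metric_def transl_diff_eq prod_eq_iff)
  next
    case False
    then have "(B *v fst u) \<bullet> (B *v fst u) > 0" by (simp only: inner_gt_zero_iff B0 not_False_eq_True)
    then show ?thesis unfolding pullback_metric_def by (rule add_pos_nonneg) simp
  qed
  have "bilinear (pullback_metric B C n)" for n
    unfolding bilinear_def pullback_metric_def
    by (intro conjI allI linearI)
      (simp_all only: lin fst_add fst_scaleR matrix_vector_right_distrib matrix_vector_mult_scaleR
        inner_simps real_scaleR_def distrib_left ac_simps)
  moreover have "pullback_metric B C n u v = pullback_metric B C n v u" for n u v
    by (simp add: pullback_metric_def inner_commute)
  moreover have "transl_diff C (- lie_mult C a n) (lie_mult C a n) (transl_diff C a n u) =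
                 transl_diff C (- n) n u" for a n u
    by (simp add: transl_diff_eq lie_bracket_simps lie_mult_def flip: scaleR_add_right scaleR_minus_right)
  moreover have "fst (transl_diff C a n u) = fst u" for a n u by (simp add: transl_diff_eq)
  ultimately show ?thesis using pos
    by (simp add: left_invariant_metric_def inner_product_def pullback_metric_def)
qed

lemma base_metric_pullback_metric:
  fixes C :: "real^'q^'q^'p"
  assumes C: "C \<in> so_tuples" "lin_indep_tuple C" and "A ** B = mat 1"
  shows "base_metric C (pullback_metric B C) = (\<lambda>x u v. (B *v u) \<bullet> (B *v v))"
proof -
  have "snd (transl_diff C (- n) n u) = 0" if "u \<in> horizontal C (pullback_metric B C) n" for n u
  proof -
    \<comment> \<open>Testing horizontality against the vertical part of \<open>u\<close> itself
      yields the squared norm of that part.\<close>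
    have "pullback_metric B C n u (0, snd (transl_diff C (- n) n u)) = 0"
      using that by (simp add: horizontal_eq[OF C(2)])
    then show ?thesis by (simp add: pullback_metric_def transl_diff_eq)
  qed
  then show ?thesis
    unfolding base_metric_def
    by (intro the1_equality ex1_base_metric C left_invariant_pullback_metric[OF assms(3)])
      (simp add: pullback_metric_def)
qed

text \<open>The form is the same for every left-invariant \<open>h\<close>: another choice of
  horizontal spaces adds to the connection a constant-coefficient, hence closed, form. The sign
  comes from \<open>d\<omega>(U, V) = - \<omega>[U, V]\<close> on left-invariant fields.\<close>

lemma base_curvature_eq:
  fixes C :: "real^'q^'q^'p"
  assumes "C \<in> so_tuples" "lin_indep_tuple C" "left_invariant_metric C h"
  shows "components (base_curvature C h) = (\<lambda>x i j. - (\<chi> k. C $ k $ i $ j))"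
proof -
  have "base_curvature C h = (\<lambda>x a b. - snd (lie_bracket C (a, 0) (b, 0)))"
    unfolding base_curvature_def
    by (intro the1_equality ex1_base_curvature assms)
      (simp add: curvature_eq[OF assms] lie_bracket_def)
  then show ?thesis
    by (intro ext) (simp add: components_def lie_bracket_alt inner_axis' matrix_vector_mult_basis column_def)
qed

section \<open>The soliton equations for constant coefficients\<close>

lemma pd_const: "pd i (\<lambda>y. c) = (\<lambda>x. 0)"
  by (simp add: pd_def fun_eq_iff)

lemma christoffel_const: "christoffel (\<lambda>x. G) = (\<lambda>x k i j. 0)"
  by (simp add: christoffel_def pd_const fun_eq_iff)

lemma ricci_const: "ricci (\<lambda>x. G) x i j = 0"
  by (simp add: ricci_def christoffel_const pd_const)

lemma lie_derivative_zero: "lie_derivative (\<lambda>_. 0) T x i j = 0"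
  by (simp add: lie_derivative_def pd_const)

lemma hodge_laplacian2_const: "hodge_laplacian2 (\<lambda>x. G) (\<lambda>x. W) x i j = 0"
  by (simp add: hodge_laplacian2_def ext_deriv1_def codiff2_def codiff3_def ext_deriv2_def[abs_def]
      cov_deriv2_def cov_deriv3_def christoffel_const pd_const)

text \<open>The contraction is the sum of the matrices \<open>(C^k)^t H C^k\<close>, with
  \<open>H\<close> the inverse base metric; skew-symmetry replaces \<open>(C^k)^t\<close> by
  \<open>- C^k\<close>.\<close>

lemma curvature_sq_const:
  fixes C :: "real^'q^'q^'p" and G H :: "real^'q^'q"
  assumes C: "C \<in> so_tuples" and GH: "G ** H = mat 1"
  shows "curvature_sq (\<lambda>x i j. G $ i $ j) (\<bullet>) (\<lambda>x i j. - (\<chi> k. C $ k $ i $ j)) x i j =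
    (- (\<Sum>k\<in>UNIV. C $ k ** H ** C $ k)) $ i $ j"
proof -
  have sk: "C $ \<alpha> $ k $ i = - C $ \<alpha> $ i $ k" for \<alpha> k i
  proof -
    have "transpose (C $ \<alpha>) $ i $ k = (- (C $ \<alpha>)) $ i $ k"
      using C by (simp add: so_tuples_def)
    then show ?thesis by (simp add: transpose_def)
  qed
  have skH: "H $ k $ l * (C $ \<alpha> $ k $ i * C $ \<alpha> $ l $ j) =
      - (C $ \<alpha> $ i $ k * (H $ k $ l * C $ \<alpha> $ l $ j))" for k l \<alpha>
    unfolding sk[of \<alpha> k i] by simp
  have inv: "inv_metric (\<lambda>x i j. G $ i $ j) x k l = H $ k $ l" for x k l
    by (simp add: inv_metric_def matrix_inv_eqI[OF GH])
  have "(\<chi> a b. (axis a 1 :: real^'p) \<bullet> axis b 1) = (mat 1 :: real^'p^'p)"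
    by (simp add: vec_eq_iff mat_def inner_axis_axis)
  then have id: "matrix_inv (\<chi> a b. (axis a 1 :: real^'p) \<bullet> axis b 1) = (mat 1 :: real^'p^'p)"
    by (simp add: matrix_inv_eqI)
  have "curvature_sq (\<lambda>x i j. G $ i $ j) (\<bullet>) (\<lambda>x i j. - (\<chi> k. C $ k $ i $ j)) x i j =
    (\<Sum>k\<in>UNIV. \<Sum>l\<in>UNIV. \<Sum>\<alpha>\<in>UNIV. H $ k $ l * (C $ \<alpha> $ k $ i * C $ \<alpha> $ l $ j))"
    unfolding curvature_sq_def inv id
    by (simp add: inner_axis' mat_def if_distrib if_distribR mult_ac cong: if_cong)
  also have "\<dots> = (\<Sum>k\<in>UNIV. \<Sum>\<alpha>\<in>UNIV. \<Sum>l\<in>UNIV. H $ k $ l * (C $ \<alpha> $ k $ i * C $ \<alpha> $ l $ j))"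
    by (intro sum.cong refl sum.swap)
  also have "\<dots> = (\<Sum>\<alpha>\<in>UNIV. \<Sum>k\<in>UNIV. \<Sum>l\<in>UNIV. H $ k $ l * (C $ \<alpha> $ k $ i * C $ \<alpha> $ l $ j))"
    by (rule sum.swap)
  also have "\<dots> = - (\<Sum>\<alpha>\<in>UNIV. \<Sum>k\<in>UNIV. \<Sum>l\<in>UNIV. C $ \<alpha> $ i $ k * (H $ k $ l * C $ \<alpha> $ l $ j))"
    by (simp only: skH sum_negf)
  also have "\<dots> = (- (\<Sum>k\<in>UNIV. C $ k ** H ** C $ k)) $ i $ j"
    unfolding matrix_mul_assoc[symmetric]
    by (simp add: matrix_matrix_mult_def sum_distrib_left)
  finally show ?thesis .
qed

text \<open>The base metric is \<open>?G\<close>, with inverse \<open>?H\<close>, so the equations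
  reduce to \<open>?S = c *\<^sub>R ?G\<close>. The congruence \<open>X \<mapsto> a X a^t\<close>
  turns \<open>?G\<close> into the identity and \<open>?S\<close> into half the moment map at
  \<open>gl_act a C\<close>.\<close>

lemma trivial_soliton_pullback_iff:
  fixes C :: "real^'q^'q^'p"
  assumes C: "C \<in> so_tuples" "lin_indep_tuple C" and aB: "transpose a ** B = mat 1"
  shows "trivial_rym_soliton C (pullback_metric B C) \<longleftrightarrow> (\<exists>c. moment_gl (gl_act a C) = c *\<^sub>R mat 1)"
proof -
  let ?t = transpose
  let ?G = "?t B ** B" and ?H = "?t a ** a"
  let ?S = "- (\<Sum>k\<in>UNIV. C $ k ** ?H ** C $ k)"
  have Ba: "B ** ?t a = mat 1" using aB by (simp add: matrix_left_right_inverse)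
  have aB': "a ** ?t B = mat 1" and Ba': "?t B ** a = mat 1"
    using arg_cong[OF aB, of ?t] arg_cong[OF Ba, of ?t] by (simp_all add: matrix_transpose_mul)
  have GH: "?G ** ?H = mat 1"
  proof -
    have "?G ** ?H = ?t B ** (B ** ?t a) ** a" by (simp only: matrix_mul_assoc)
    then show ?thesis by (simp add: Ba Ba')
  qed
  have "(B *v axis i 1) \<bullet> (B *v axis j 1) = ?G $ i $ j" for i j
    by (simp add: matrix_vector_mult_basis matrix_mult_transpose_dot_column)
  then have g: "components (base_metric C (pullback_metric B C)) = (\<lambda>x i j. ?G $ i $ j)"
    by (intro ext) (simp add: components_def base_metric_pullback_metric[OF C aB])
  have k: "fibre_metric (pullback_metric B C) = (\<bullet>)"
    by (intro ext) (simp add: fibre_metric_def pullback_metric_def transl_diff_eq)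
  have "trivial_rym_soliton C (pullback_metric B C) \<longleftrightarrow> (\<exists>c. \<forall>i j. ?S $ i $ j = c * ?G $ i $ j)"
    unfolding trivial_rym_soliton_def rym_soliton_eqs_def Let_def g k
      base_curvature_eq[OF C left_invariant_pullback_metric[OF aB]]
      hodge_laplacian2_const ricci_const lie_derivative_zero curvature_sq_const[OF C(1) GH]
    by simp
  also have "\<dots> \<longleftrightarrow> (\<exists>c. ?S = c *\<^sub>R ?G)" by (simp add: vec_eq_iff)
  also have "\<dots> \<longleftrightarrow> (\<exists>c. a ** ?S ** ?t a = c *\<^sub>R mat 1)"
  proof -
    have 1: "a ** (c *\<^sub>R ?G) ** ?t a = c *\<^sub>R mat 1" for c
    proof -
      have "a ** ?G ** ?t a = (a ** ?t B) ** (B ** ?t a)" by (simp only: matrix_mul_assoc)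
      then show ?thesis by (simp add: matrix_mult_bilinear aB' Ba)
    qed
    \<comment> \<open>Congruence by \<open>?t B\<close> undoes congruence by \<open>a\<close>, which
      gives the converse direction.\<close>
    have 2: "X = ?t B ** (a ** X ** ?t a) ** B" for X :: "real^'q^'q"
    proof -
      have "?t B ** (a ** X ** ?t a) ** B = (?t B ** a) ** X ** (?t a ** B)"
        by (simp only: matrix_mul_assoc)
      then show ?thesis by (simp add: aB Ba')
    qed
    have 3: "?t B ** (c *\<^sub>R mat 1) ** B = c *\<^sub>R ?G" for c by (simp add: matrix_mult_bilinear)
    show ?thesis
    proof (intro ex_cong1 iffI)
      show "a ** ?S ** ?t a = c *\<^sub>R mat 1" if "?S = c *\<^sub>R ?G" for c
        unfolding that by (rule 1)
      show "?S = c *\<^sub>R ?G" if "a ** ?S ** ?t a = c *\<^sub>R mat 1" for c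
        using 2[of ?S] unfolding that 3 .
    qed
  qed
  \<comment> \<open>The middle factor \<open>?H = ?t a ** a\<close> splits, one half going to each
    copy of \<open>C $ k\<close>.\<close>
  also have "a ** ?S ** ?t a = - (\<Sum>k\<in>UNIV. gl_act a C $ k ** gl_act a C $ k)"
    by (simp add: gl_act_def matrix_mult_bilinear matrix_mult_sum_left matrix_mult_sum_right matrix_mul_assoc)
  also have "\<dots> = (1/2) *\<^sub>R moment_gl (gl_act a C)" by (simp add: moment_gl_def)
  also have "(\<exists>c. (1/2) *\<^sub>R moment_gl (gl_act a C) = c *\<^sub>R mat 1) \<longleftrightarrow>
      (\<exists>c. moment_gl (gl_act a C) = c *\<^sub>R mat 1)" (is "?L \<longleftrightarrow> ?R")
  proof
    assume ?L
    then obtain c where "(1/2) *\<^sub>R moment_gl (gl_act a C) = c *\<^sub>R mat 1" ..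
    then have "2 *\<^sub>R (1/2) *\<^sub>R moment_gl (gl_act a C) = (2 * c) *\<^sub>R mat 1" by simp
    then show ?R by auto
  next
    assume ?R
    then obtain c where "moment_gl (gl_act a C) = c *\<^sub>R mat 1" ..
    then show ?L by (intro exI[of _ "c/2"]) simp
  qed
  finally show ?thesis .
qed

theorem corollary3p24:
  fixes C :: "real^'q^'q^'p"
  assumes "C \<in> so_tuples" and "lin_indep_tuple C"
  shows "(closedin (top_of_set (so_tuples :: (real^'q^'q^'p) set)) (sl_orbit C) \<longrightarrow>
            (\<exists>h. left_invariant_metric C h \<and> trivial_rym_soliton C h)) \<and>
         (\<forall>C' :: real^'q^'q^'p. C' \<in> so_tuples \<longrightarrow> lin_indep_tuple C' \<longrightarrow>
            (trivial_rym_soliton C' (std_metric C') \<longleftrightarrow> geodesically_flow_invariant C'))"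
proof (intro conjI impI allI)
  assume "closedin (top_of_set so_tuples) (sl_orbit C)"
  then obtain a c where a: "det a = 1" "moment_gl (gl_act a C) = c *\<^sub>R mat 1"
    using closed_orbit_moment_scalar[OF assms(1)] by blast
  have "invertible (transpose a)"
    by (simp add: invertible_det_nz a(1))
  then obtain B where B: "transpose a ** B = mat 1"
    unfolding invertible_def by blast
  show "\<exists>h. left_invariant_metric C h \<and> trivial_rym_soliton C h"
    using left_invariant_pullback_metric[OF B] trivial_soliton_pullback_iff[OF assms B] a(2) by blast
next
  fix C' :: "real^'q^'q^'p"
  assume C': "C' \<in> so_tuples" "lin_indep_tuple C'"
  show "trivial_rym_soliton C' (std_metric C') \<longleftrightarrow> geodesically_flow_invariant C'"
    \<comment> \<open>For the identity matrix the pullback metric is the standard one and the tuple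
      is not moved.\<close>
    using trivial_soliton_pullback_iff[OF C', of "mat 1" "mat 1"]
    by (simp add: pullback_metric_mat_1 gl_act_mat_1 geodesically_flow_invariant_def
        sl_minimal_iff_moment_scalar[OF C'(1)])
qed

end
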